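(* Let $p$ be an odd prime, let $k$ be a nonzero integer, and let $\nu(k)$ be the $p$-adic valuation of $k$. Let $C$ be the cochain complex of $\mathbb{Z}_{(p)}$-modules which in degrees $(2p-2)k-1,\ (2p-2)k,\ (2p-2)k+1,\ (2p-2)k+2$ is $$0\longrightarrow \mathbb{Z}_{(p)}^{\mathbb{N}} \xrightarrow{d^{(2p-2)k-1}} \mathbb{Z}_{(p)}^{\mathbb{N}}\oplus \mathbb{Z}_{(p)}^{\mathbb{N}} \xrightarrow{d^{(2p-2)k}} \mathbb{Z}_{(p)}^{\mathbb{N}}\oplus\mathbb{Q}\xrightarrow{d^{(2p-2)k+1}}\mathbb{Q}\longrightarrow 0,$$ with $$d^{(2p-2)k-1}(\langle a_m\rangle)=(\Psi^*\langle a_m\rangle,\Psi_*\langle a_m\rangle),\qquad d^{(2p-2)k}(\langle a_m\rangle,\langle b_m\rangle)=(\Psi_*\langle a_m\rangle-\Psi^*\langle b_m\rangle,\,0),$$ $$d^{(2p-2)k+1}(\langle a_m\rangle,b)=p^{\nu(k)+1}b,$$ where $\Psi^*$ and $\Psi_*$ are the maps defined in the context. Then $H^{(2p-2)k+1}(C)\cong\mathbb{Z}/p^{\nu(k)+1}$, and the cohomology of $C$ in the degrees $(2p-2)k-1$, $(2p-2)k$ and $(2p-2)k+2$ is zero.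
   Context: $\mathbb{N}=\{0,1,2,\dots\}$, and $\mathbb{Z}_{(p)}$ is the ring of $p$-local integers. $\mathbb{Z}_{(p)}^{\mathbb{N}}$ is the module of all sequences $\langle a_m\rangle=(a_m)_{m\ge 0}$ with $a_m\in\mathbb{Z}_{(p)}$. Fix an integer $r$ whose class generates the cyclic group $(\mathbb{Z}/p^2)^\times$; then $r$ is a unit in $\mathbb{Z}_{(p)}$. For $m\ge 1$ put $s(m)=\frac{m+1}{2}$ if $m$ is odd and $s(m)=-\frac{m}{2}$ if $m$ is even. The map $\Psi_*:\mathbb{Z}_{(p)}^{\mathbb{N}}\to\mathbb{Z}_{(p)}^{\mathbb{N}}$ is multiplication by $p^{\nu(k)+1}$. The map $\Psi^*:\mathbb{Z}_{(p)}^{\mathbb{N}}\to\mathbb{Z}_{(p)}^{\mathbb{N}}$ sends $\langle a_m\rangle$ to the sequence whose $0$-th term is $p^{\nu(k)+1}a_0$ and whose $m$-th term, for $m\ge1$, is $a_m(r^{s(m)}-1+p^{\nu(k)+1})+a_{m-1}$. This complex is the explicit representation, in degrees around $(2p-2)k$, of the endomorphism dga of the compact generator of Franke's exotic algebraic model for the $K_{(p)}$-local stable homotopy category. *)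

theory Defs
  imports "HOL-Algebra.Module" "HOL-Algebra.AbelCoset" "HOL-Algebra.Generated_Groups" "HOL-Number_Theory.Residues"
begin

section \<open>Modules\<close>

text \<open>
  A module record extends a ring record, but the locale \<^locale>\<open>module\<close> never looks at the
  multiplicative fields; they are left \<^const>\<open>undefined\<close> below.
\<close>

definition mod_hom :: "('a, 'm) ring_scheme \<Rightarrow> ('a, 'b) module \<Rightarrow> ('a, 'c) module \<Rightarrow> ('b \<Rightarrow> 'c) set"
  where "mod_hom R M N =
    {f \<in> carrier M \<rightarrow> carrier N.
      (\<forall>x\<in>carrier M. \<forall>y\<in>carrier M. f (x \<oplus>\<^bsub>M\<^esub> y) = f x \<oplus>\<^bsub>N\<^esub> f y) \<and>
      (\<forall>a\<in>carrier R. \<forall>x\<in>carrier M. f (a \<odot>\<^bsub>M\<^esub> x) = a \<odot>\<^bsub>N\<^esub> f x)}"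

definition module_isomorphic :: "('a, 'm) ring_scheme \<Rightarrow> ('a, 'b) module \<Rightarrow> ('a, 'c) module \<Rightarrow> bool"
  where "module_isomorphic R M N \<longleftrightarrow>
    (\<exists>f\<in>mod_hom R M N. bij_betw f (carrier M) (carrier N))"

definition is_zero_module :: "('a, 'b) module \<Rightarrow> bool"
  where "is_zero_module M \<longleftrightarrow> carrier M = {\<zero>\<^bsub>M\<^esub>}"

definition zero_part :: "('a, 'b) module \<Rightarrow> ('a, 'b) module"
  where "zero_part M = M\<lparr>carrier := {\<zero>\<^bsub>M\<^esub>}\<rparr>"

definition direct_sum :: "('a, 'b) module \<Rightarrow> ('a, 'c) module \<Rightarrow> ('a, 'b \<times> 'c) module"
  where "direct_sum M N =
    \<lparr>carrier = carrier M \<times> carrier N, monoid.mult = undefined, one = undefined,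
     zero = (\<zero>\<^bsub>M\<^esub>, \<zero>\<^bsub>N\<^esub>),
     add = (\<lambda>(x, y) (x', y'). (x \<oplus>\<^bsub>M\<^esub> x', y \<oplus>\<^bsub>N\<^esub> y')),
     smult = (\<lambda>a (x, y). (a \<odot>\<^bsub>M\<^esub> x, a \<odot>\<^bsub>N\<^esub> y))\<rparr>"

definition seq_module :: "('a, 'm) ring_scheme \<Rightarrow> ('a, nat \<Rightarrow> 'a) module"
  where "seq_module R =
    \<lparr>carrier = {a. \<forall>m. a m \<in> carrier R}, monoid.mult = undefined, one = undefined,
     zero = (\<lambda>m. \<zero>\<^bsub>R\<^esub>),
     add = (\<lambda>a b m. a m \<oplus>\<^bsub>R\<^esub> b m),
     smult = (\<lambda>c a m. c \<otimes>\<^bsub>R\<^esub> a m)\<rparr>"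

text \<open>
  The elementwise product of a scalar with a coset of \<open>N\<close> need not be a whole coset (take the
  scalar to be zero), hence the union of cosets in the scalar multiplication.
\<close>

definition quot_module :: "('a, 'b) module \<Rightarrow> 'b set \<Rightarrow> ('a, 'b set) module"
  where "quot_module M N =
    \<lparr>carrier = a_rcosets\<^bsub>M\<^esub> N, monoid.mult = undefined, one = undefined,
     zero = N,
     add = set_add M,
     smult = (\<lambda>a X. \<Union>x\<in>X. N +>\<^bsub>M\<^esub> (a \<odot>\<^bsub>M\<^esub> x))\<rparr>"

lemma module_zero_part:
  assumes "module R M"
  shows "module R (zero_part M)"
proof -
  interpret module R M by fact
  have "submodule {\<zero>\<^bsub>M\<^esub>} R M"
    by (rule submoduleI) auto
  then show ?thesis
    unfolding zero_part_def using assms by (rule submodule.submodule_is_module)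
qed

lemma module_direct_sum:
  assumes "module R M" "module R N"
  shows "module R (direct_sum M N)"
proof -
  interpret M: module R M by fact
  interpret N: module R N by fact
  show ?thesis
  proof (rule moduleI)
    show "abelian_group (direct_sum M N)"
    proof (rule abelian_groupI)
      fix x assume "x \<in> carrier (direct_sum M N)"
      then show "\<exists>y\<in>carrier (direct_sum M N).
          y \<oplus>\<^bsub>direct_sum M N\<^esub> x = \<zero>\<^bsub>direct_sum M N\<^esub>"
        by (intro bexI[of _ "(\<ominus>\<^bsub>M\<^esub> fst x, \<ominus>\<^bsub>N\<^esub> snd x)"])
          (auto simp: direct_sum_def M.l_neg N.l_neg)
    qed (auto simp: direct_sum_def M.a_ac N.a_ac)
  qed (auto simp: direct_sum_def M.smult_l_distr N.smult_l_distr M.smult_r_distr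
      N.smult_r_distr M.smult_assoc1 N.smult_assoc1 M.is_cring)
qed

lemma module_seq_module:
  assumes "cring R"
  shows "module R (seq_module R)"
proof -
  interpret cring R by fact
  show ?thesis
  proof (rule moduleI)
    show "abelian_group (seq_module R)"
    proof (rule abelian_groupI)
      fix x assume "x \<in> carrier (seq_module R)"
      then show "\<exists>y\<in>carrier (seq_module R). y \<oplus>\<^bsub>seq_module R\<^esub> x = \<zero>\<^bsub>seq_module R\<^esub>"
        by (intro bexI[of _ "\<lambda>m. \<ominus>\<^bsub>R\<^esub> x m"]) (auto simp: seq_module_def l_neg)
    qed (auto simp: seq_module_def a_ac)
  qed (auto simp: seq_module_def l_distr r_distr m_assoc assms)
qed

lemma quot_module_smult:
  assumes "module R M" "submodule N R M" "a \<in> carrier R" "x \<in> carrier M"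
  shows "a \<odot>\<^bsub>quot_module M N\<^esub> (N +>\<^bsub>M\<^esub> x) = N +>\<^bsub>M\<^esub> (a \<odot>\<^bsub>M\<^esub> x)"
proof -
  interpret module R M by fact
  have sub: "subgroup N (add_monoid M)"
    using assms(2) by (simp add: submodule_def)
  have N: "N \<subseteq> carrier M"
    using submoduleE(1)[OF assms(2)] .
  have "N +>\<^bsub>M\<^esub> (a \<odot>\<^bsub>M\<^esub> y) = N +>\<^bsub>M\<^esub> (a \<odot>\<^bsub>M\<^esub> x)" if "y \<in> N +>\<^bsub>M\<^esub> x" for y
  proof -
    from that obtain h where h: "h \<in> N" "y = h \<oplus>\<^bsub>M\<^esub> x"
      by (auto simp: a_r_coset_def')
    then have "h \<in> carrier M" using N by blast
    then have "a \<odot>\<^bsub>M\<^esub> y = a \<odot>\<^bsub>M\<^esub> h \<oplus>\<^bsub>M\<^esub> a \<odot>\<^bsub>M\<^esub> x"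
      using h assms by (simp add: smult_r_distr)
    moreover have "a \<odot>\<^bsub>M\<^esub> h \<in> N"
      using submoduleE(4)[OF assms(2)] assms(3) h by blast
    ultimately have "a \<odot>\<^bsub>M\<^esub> y \<in> N +>\<^bsub>M\<^esub> (a \<odot>\<^bsub>M\<^esub> x)"
      by (auto simp: a_r_coset_def')
    then show ?thesis
      using M.a_repr_independence[OF _ _ sub] assms by simp
  qed
  moreover have "x \<in> N +>\<^bsub>M\<^esub> x"
    using sub assms(4) by (metis M.a_group a_r_coset_def group.rcos_self partial_object.select_convs(1))
  ultimately have "(\<Union>y\<in>N +>\<^bsub>M\<^esub> x. N +>\<^bsub>M\<^esub> (a \<odot>\<^bsub>M\<^esub> y)) = N +>\<^bsub>M\<^esub> (a \<odot>\<^bsub>M\<^esub> x)"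
    by (intro UN_constant_eq) blast+
  then show ?thesis
    by (simp add: quot_module_def)
qed

lemma module_quot_module:
  assumes "module R M" "submodule N R M"
  shows "module R (quot_module M N)"
proof -
  interpret module R M by fact
  have sub: "subgroup N (add_monoid M)"
    using assms(2) by (simp add: submodule_def)
  interpret N: abelian_subgroup N M
    by (intro abelian_subgroupI3 additive_subgroupI sub M.abelian_group_axioms)
  note sm = quot_module_smult[OF assms]
  have carr: "X \<in> carrier (quot_module M N) \<longleftrightarrow> (\<exists>x\<in>carrier M. X = N +>\<^bsub>M\<^esub> x)" for X
    by (auto simp: quot_module_def A_RCOSETS_def')
  have add: "(N +>\<^bsub>M\<^esub> x) \<oplus>\<^bsub>quot_module M N\<^esub> (N +>\<^bsub>M\<^esub> y) = N +>\<^bsub>M\<^esub> (x \<oplus>\<^bsub>M\<^esub> y)"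
    if "x \<in> carrier M" "y \<in> carrier M" for x y
    using that by (simp add: quot_module_def N.a_rcos_sum)
  have zero: "\<zero>\<^bsub>quot_module M N\<^esub> = N +>\<^bsub>M\<^esub> \<zero>\<^bsub>M\<^esub>"
    using N.a_subset by (simp add: quot_module_def)
  show ?thesis
  proof (rule moduleI)
    show "abelian_group (quot_module M N)"
    proof (rule abelian_groupI)
      fix X assume "X \<in> carrier (quot_module M N)"
      then obtain x where x: "x \<in> carrier M" "X = N +>\<^bsub>M\<^esub> x"
        by (auto simp: carr)
      then show "\<exists>Y\<in>carrier (quot_module M N).
          Y \<oplus>\<^bsub>quot_module M N\<^esub> X = \<zero>\<^bsub>quot_module M N\<^esub>"
        by (intro bexI[of _ "N +>\<^bsub>M\<^esub> (\<ominus>\<^bsub>M\<^esub> x)"]) (auto simp: carr add zero M.l_neg)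
    next
      show "\<zero>\<^bsub>quot_module M N\<^esub> \<in> carrier (quot_module M N)"
        unfolding carr zero by blast
    next
      fix X assume "X \<in> carrier (quot_module M N)"
      then show "\<zero>\<^bsub>quot_module M N\<^esub> \<oplus>\<^bsub>quot_module M N\<^esub> X = X"
        unfolding carr zero by (auto simp: add)
    next
      fix X Y assume "X \<in> carrier (quot_module M N)" "Y \<in> carrier (quot_module M N)"
      then obtain x y where xy: "x \<in> carrier M" "X = N +>\<^bsub>M\<^esub> x" "y \<in> carrier M" "Y = N +>\<^bsub>M\<^esub> y"
        unfolding carr by blast
      then show "X \<oplus>\<^bsub>quot_module M N\<^esub> Y \<in> carrier (quot_module M N)"
        by (auto simp: carr add)
      from xy show "X \<oplus>\<^bsub>quot_module M N\<^esub> Y = Y \<oplus>\<^bsub>quot_module M N\<^esub> X"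
        by (simp add: add M.a_comm)
    next
      fix X Y Z assume "X \<in> carrier (quot_module M N)" "Y \<in> carrier (quot_module M N)"
        "Z \<in> carrier (quot_module M N)"
      then obtain x y z where "x \<in> carrier M" "X = N +>\<^bsub>M\<^esub> x" "y \<in> carrier M" "Y = N +>\<^bsub>M\<^esub> y"
        "z \<in> carrier M" "Z = N +>\<^bsub>M\<^esub> z"
        unfolding carr by blast
      then show "X \<oplus>\<^bsub>quot_module M N\<^esub> Y \<oplus>\<^bsub>quot_module M N\<^esub> Z =
          X \<oplus>\<^bsub>quot_module M N\<^esub> (Y \<oplus>\<^bsub>quot_module M N\<^esub> Z)"
        by (simp add: add M.a_assoc)
    qed
  next
    fix a X Y assume a: "a \<in> carrier R" and "X \<in> carrier (quot_module M N)"
      "Y \<in> carrier (quot_module M N)"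
    then obtain x y where "x \<in> carrier M" "X = N +>\<^bsub>M\<^esub> x" "y \<in> carrier M" "Y = N +>\<^bsub>M\<^esub> y"
      unfolding carr by blast
    with a show "a \<odot>\<^bsub>quot_module M N\<^esub> (X \<oplus>\<^bsub>quot_module M N\<^esub> Y) =
        a \<odot>\<^bsub>quot_module M N\<^esub> X \<oplus>\<^bsub>quot_module M N\<^esub> a \<odot>\<^bsub>quot_module M N\<^esub> Y"
      by (simp add: add sm smult_r_distr)
  next
    fix a b X assume a: "a \<in> carrier R" "b \<in> carrier R" and "X \<in> carrier (quot_module M N)"
    then obtain x where x: "x \<in> carrier M" "X = N +>\<^bsub>M\<^esub> x"
      unfolding carr by blast
    with a show "(a \<oplus>\<^bsub>R\<^esub> b) \<odot>\<^bsub>quot_module M N\<^esub> X =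
        a \<odot>\<^bsub>quot_module M N\<^esub> X \<oplus>\<^bsub>quot_module M N\<^esub> b \<odot>\<^bsub>quot_module M N\<^esub> X"
      by (simp add: add sm smult_l_distr)
    from a x show "(a \<otimes>\<^bsub>R\<^esub> b) \<odot>\<^bsub>quot_module M N\<^esub> X =
        a \<odot>\<^bsub>quot_module M N\<^esub> (b \<odot>\<^bsub>quot_module M N\<^esub> X)"
      by (simp add: sm smult_assoc1)
  next
    fix a X assume a: "a \<in> carrier R" and "X \<in> carrier (quot_module M N)"
    then obtain x where x: "x \<in> carrier M" "X = N +>\<^bsub>M\<^esub> x"
      unfolding carr by blast
    with a show "a \<odot>\<^bsub>quot_module M N\<^esub> X \<in> carrier (quot_module M N)"
      by (auto simp: carr sm)
  next
    fix X assume "X \<in> carrier (quot_module M N)"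
    then obtain x where x: "x \<in> carrier M" "X = N +>\<^bsub>M\<^esub> x"
      unfolding carr by blast
    then show "\<one>\<^bsub>R\<^esub> \<odot>\<^bsub>quot_module M N\<^esub> X = X"
      by (simp add: sm)
  qed (rule R.is_cring)
qed


section \<open>Cochain complexes\<close>

locale cochain_complex =
  fixes R :: "('a, 'm) ring_scheme" and C :: "int \<Rightarrow> ('a, 'b) module" and d :: "int \<Rightarrow> 'b \<Rightarrow> 'b"
  assumes module: "module R (C n)"
    and d_hom: "d n \<in> mod_hom R (C n) (C (n + 1))"
    and d_d: "x \<in> carrier (C n) \<Longrightarrow> d (n + 1) (d n x) = \<zero>\<^bsub>C (n + 2)\<^esub>"

definition cohomology :: "(int \<Rightarrow> ('a, 'b) module) \<Rightarrow> (int \<Rightarrow> 'b \<Rightarrow> 'b) \<Rightarrow> int \<Rightarrow> ('a, 'b set) module"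
  where "cohomology C d n =
    quot_module ((C n)\<lparr>carrier := a_kernel (C n) (C (n + 1)) (d n)\<rparr>)
      (d (n - 1) ` carrier (C (n - 1)))"

lemma mod_hom_abelian_group_hom:
  assumes "module R M" "module R N" "f \<in> mod_hom R M N"
  shows "abelian_group_hom M N f"
proof -
  interpret M: module R M by fact
  interpret N: module R N by fact
  show ?thesis
    by (intro abelian_group_homI group_hom.intro group_hom_axioms.intro homI
        M.abelian_group_axioms N.abelian_group_axioms M.a_group N.a_group)
      (use assms(3) in \<open>auto simp: mod_hom_def\<close>)
qed

lemma submodule_a_kernel:
  assumes "module R M" "module R N" "f \<in> mod_hom R M N"
  shows "submodule (a_kernel M N f) R M"
proof -
  interpret M: module R M by fact
  interpret N: module R N by fact
  interpret f: abelian_group_hom M N f by (rule mod_hom_abelian_group_hom[OF assms])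
  have sm: "f (a \<odot>\<^bsub>M\<^esub> x) = a \<odot>\<^bsub>N\<^esub> f x" if "a \<in> carrier R" "x \<in> carrier M" for a x
    using assms(3) that by (auto simp: mod_hom_def)
  show ?thesis
    unfolding a_kernel_def'
  proof (rule M.submoduleI)
    fix x assume "x \<in> {x \<in> carrier M. f x = \<zero>\<^bsub>N\<^esub>}"
    then show "\<ominus>\<^bsub>M\<^esub> x \<in> {x \<in> carrier M. f x = \<zero>\<^bsub>N\<^esub>}"
      using f.hom_a_inv[of x] N.add.inv_one by (simp add: a_inv_def)
  qed (simp_all add: sm Collect_mono)
qed

lemma submodule_image:
  assumes "module R M" "module R N" "f \<in> mod_hom R M N"
  shows "submodule (f ` carrier M) R N"
proof -
  interpret M: module R M by fact
  interpret N: module R N by fact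
  interpret f: abelian_group_hom M N f by (rule mod_hom_abelian_group_hom[OF assms])
  have sm: "f (a \<odot>\<^bsub>M\<^esub> x) = a \<odot>\<^bsub>N\<^esub> f x" if "a \<in> carrier R" "x \<in> carrier M" for a x
    using assms(3) that by (auto simp: mod_hom_def)
  show ?thesis
  proof (rule N.submoduleI)
    show "\<zero>\<^bsub>N\<^esub> \<in> f ` carrier M"
      by (rule image_eqI[of _ _ "\<zero>\<^bsub>M\<^esub>"]) auto
  qed (auto simp flip: f.hom_add f.hom_a_inv sm)
qed

lemma (in cochain_complex) module_cohomology: "module R (cohomology C d n)"
proof -
  let ?K = "a_kernel (C n) (C (n + 1)) (d n)" and ?B = "d (n - 1) ` carrier (C (n - 1))"
  interpret M: module R "C n" by (rule module)
  have K: "submodule ?K R (C n)"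
    by (intro submodule_a_kernel module d_hom)
  have mK: "module R ((C n)\<lparr>carrier := ?K\<rparr>)"
    by (rule submodule.submodule_is_module[OF K module])
  have hom: "d (n - 1) \<in> mod_hom R (C (n - 1)) (C n)"
    using d_hom[of "n - 1"] by simp
  have B: "submodule ?B R (C n)"
    by (intro submodule_image module hom)
  have sub: "?B \<subseteq> ?K"
    using d_d[of _ "n - 1"] hom by (auto simp: a_kernel_def' mod_hom_def add.commute)
  have "module R ((C n)\<lparr>carrier := ?K\<rparr>\<lparr>carrier := ?B\<rparr>)"
    using submodule.submodule_is_module[OF B module] by simp
  then have "submodule ?B R ((C n)\<lparr>carrier := ?K\<rparr>)"
    using module.module_incl_imp_submodule[OF mK] sub by simp
  then show ?thesis
    unfolding cohomology_def by (intro module_quot_module mK)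
qed


section \<open>The ring of p-local integers and some modules over it\<close>

definition Zloc :: "nat \<Rightarrow> rat ring"
  where "Zloc p =
    \<lparr>carrier = {of_int a / of_int b | a b. \<not> int p dvd b},
     monoid.mult = (*), one = 1, zero = 0, add = (+)\<rparr>"

definition Q_module :: "(rat, rat) module"
  where "Q_module =
    \<lparr>carrier = UNIV, monoid.mult = undefined, one = undefined, zero = 0, add = (+), smult = (*)\<rparr>"

text \<open>
  \<open>\<int>/p\<^sup>n\<close> with its (unique) structure of a module over the p-local integers: the scalar \<open>x\<close> sends
  the class of \<open>c\<close> to the class of the integers \<open>z\<close> with \<open>x c - z\<close> in \<open>p\<^sup>n \<int>\<^sub>(\<^sub>p\<^sub>)\<close>.
\<close>

definition Zmod_module :: "nat \<Rightarrow> nat \<Rightarrow> (rat, int) module"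
  where "Zmod_module p n =
    ring.extend (residue_ring (int p ^ n))
      (module.fields (\<lambda>x c. THE z. z \<in> carrier (residue_ring (int p ^ n)) \<and>
        (\<exists>y\<in>carrier (Zloc p). x * of_int c - of_int z = of_int (int p ^ n) * y)))"


section \<open>The complex\<close>

definition s_exp :: "nat \<Rightarrow> int"
  where "s_exp m = (if odd m then (int m + 1) div 2 else - (int m div 2))"

definition Psi_lower :: "nat \<Rightarrow> int \<Rightarrow> (nat \<Rightarrow> rat) \<Rightarrow> (nat \<Rightarrow> rat)"
  where "Psi_lower p k a = (\<lambda>m. of_nat p ^ (multiplicity (int p) k + 1) * a m)"

definition Psi_upper :: "nat \<Rightarrow> int \<Rightarrow> int \<Rightarrow> (nat \<Rightarrow> rat) \<Rightarrow> (nat \<Rightarrow> rat)"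
  where "Psi_upper p r k a = (\<lambda>m.
    if m = 0 then of_nat p ^ (multiplicity (int p) k + 1) * a 0
    else a m * (of_int r powi s_exp m - 1 + of_nat p ^ (multiplicity (int p) k + 1)) + a (m - 1))"

text \<open>
  The terms of a complex must share one type, here that of
  \<open>\<int>\<^sub>(\<^sub>p\<^sub>)\<^sup>\<nat> \<oplus> \<int>\<^sub>(\<^sub>p\<^sub>)\<^sup>\<nat> \<oplus> \<rat>\<close>. Every term is a direct sum of three modules in which the summands
  that do not occur in the given degree are zero: for instance \<open>\<int>\<^sub>(\<^sub>p\<^sub>)\<^sup>\<nat> \<oplus> \<rat>\<close> appears as
  \<open>\<int>\<^sub>(\<^sub>p\<^sub>)\<^sup>\<nat> \<oplus> 0 \<oplus> \<rat>\<close>. Outside of the degrees \<open>(2p-2)k-1, \<dots>, (2p-2)k+2\<close> the complex is zero.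
\<close>

type_synonym cochain = "(nat \<Rightarrow> rat) \<times> (nat \<Rightarrow> rat) \<times> rat"

definition C_mod :: "nat \<Rightarrow> int \<Rightarrow> int \<Rightarrow> (rat, cochain) module"
  where "C_mod p k n =
    (let e = (2 * int p - 2) * k; Z = seq_module (Zloc p); Q = Q_module in
      if n = e - 1 then direct_sum Z (direct_sum (zero_part Z) (zero_part Q))
      else if n = e then direct_sum Z (direct_sum Z (zero_part Q))
      else if n = e + 1 then direct_sum Z (direct_sum (zero_part Z) Q)
      else if n = e + 2 then direct_sum (zero_part Z) (direct_sum (zero_part Z) Q)
      else direct_sum (zero_part Z) (direct_sum (zero_part Z) (zero_part Q)))"

definition C_diff :: "nat \<Rightarrow> int \<Rightarrow> int \<Rightarrow> int \<Rightarrow> cochain \<Rightarrow> cochain"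
  where "C_diff p r k n =
    (let e = (2 * int p - 2) * k in
      if n = e - 1 then (\<lambda>(a, _, _). (Psi_upper p r k a, Psi_lower p k a, 0))
      else if n = e then
        (\<lambda>(a, b, _). (\<lambda>m. Psi_lower p k a m - Psi_upper p r k b m, \<lambda>m. 0, 0))
      else if n = e + 1 then
        (\<lambda>(a, _, b). (\<lambda>m. 0, \<lambda>m. 0, of_nat p ^ (multiplicity (int p) k + 1) * b))
      else (\<lambda>_. (\<lambda>m. 0, \<lambda>m. 0, 0)))"

lemma Zloc_simps [simp]:
  "x \<oplus>\<^bsub>Zloc p\<^esub> y = x + y" "x \<otimes>\<^bsub>Zloc p\<^esub> y = x * y" "\<zero>\<^bsub>Zloc p\<^esub> = 0" "\<one>\<^bsub>Zloc p\<^esub> = 1"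
  by (simp_all add: Zloc_def)

context
  fixes p :: nat
  assumes p: "prime p"
begin

lemma ZlocI: "\<not> int p dvd b \<Longrightarrow> of_int a / of_int b \<in> carrier (Zloc p)"
  by (auto simp: Zloc_def)

lemma ZlocE:
  assumes "x \<in> carrier (Zloc p)"
  obtains a b where "\<not> int p dvd b" "b \<noteq> 0" "x = of_int a / of_int b"
  using assms by (force simp: Zloc_def)

lemma prime_int: "prime (int p)"
  using p by simp

lemma Zloc_of_int [simp]: "of_int a \<in> carrier (Zloc p)"
proof -
  have "\<not> int p dvd 1"
    using prime_int not_prime_unit by blast
  from ZlocI[OF this, of a] show ?thesis by simp
qed

lemma Zloc_0_1 [simp]: "0 \<in> carrier (Zloc p)" "1 \<in> carrier (Zloc p)" "of_nat n \<in> carrier (Zloc p)"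
  using Zloc_of_int[of 0] Zloc_of_int[of 1] Zloc_of_int[of "int n"] by simp_all

lemma Zloc_mult [simp]:
  assumes "x \<in> carrier (Zloc p)" "y \<in> carrier (Zloc p)"
  shows "x * y \<in> carrier (Zloc p)"
proof -
  from assms obtain a b c d where *: "\<not> int p dvd b" "x = of_int a / of_int b"
    "\<not> int p dvd d" "y = of_int c / of_int d"
    by (elim ZlocE)
  then have "\<not> int p dvd b * d" "x * y = of_int (a * c) / of_int (b * d)"
    using prime_int by (auto simp: prime_dvd_mult_iff)
  then show ?thesis by (metis ZlocI)
qed

lemma Zloc_add [simp]:
  assumes "x \<in> carrier (Zloc p)" "y \<in> carrier (Zloc p)"
  shows "x + y \<in> carrier (Zloc p)"
proof -
  from assms obtain a b c d where *: "\<not> int p dvd b" "b \<noteq> 0" "x = of_int a / of_int b"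
    "\<not> int p dvd d" "d \<noteq> 0" "y = of_int c / of_int d"
    by (elim ZlocE)
  then have "\<not> int p dvd b * d" "x + y = of_int (a * d + c * b) / of_int (b * d)"
    using prime_int by (auto simp: prime_dvd_mult_iff field_simps)
  then show ?thesis by (metis ZlocI)
qed

lemma Zloc_minus [simp]: "x \<in> carrier (Zloc p) \<Longrightarrow> - x \<in> carrier (Zloc p)"
  using Zloc_mult[of "-1" x] Zloc_of_int[of "-1"] by simp

lemma Zloc_diff [simp]:
  "x \<in> carrier (Zloc p) \<Longrightarrow> y \<in> carrier (Zloc p) \<Longrightarrow> x - y \<in> carrier (Zloc p)"
  using Zloc_add[of x "- y"] by simp

lemma Zloc_power [simp]: "x \<in> carrier (Zloc p) \<Longrightarrow> x ^ n \<in> carrier (Zloc p)"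
  by (induction n) auto

lemma Zloc_powi:
  assumes "coprime r (int p)"
  shows "of_int r powi n \<in> carrier (Zloc p)"
proof -
  have "\<not> int p dvd r"
    using assms prime_int by (metis coprime_absorb_right dvd_refl not_prime_unit)
  then have "inverse (of_int r) \<in> carrier (Zloc p)"
    using ZlocI[of r 1] by (simp add: divide_inverse)
  then show ?thesis
    by (auto simp: power_int_def)
qed

lemma cring_Zloc: "cring (Zloc p)"
proof (rule cringI)
  show "abelian_group (Zloc p)"
  proof (rule abelian_groupI)
    fix x assume "x \<in> carrier (Zloc p)"
    then show "\<exists>y\<in>carrier (Zloc p). y \<oplus>\<^bsub>Zloc p\<^esub> x = \<zero>\<^bsub>Zloc p\<^esub>"
      by (intro bexI[of _ "- x"]) auto
  qed auto
  show "comm_monoid (Zloc p)"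
    by (rule comm_monoidI) auto
qed (auto simp: algebra_simps)

lemma module_Q_module: "module (Zloc p) Q_module"
proof (rule moduleI)
  show "abelian_group Q_module"
  proof (rule abelian_groupI)
    fix x assume "x \<in> carrier Q_module"
    then show "\<exists>y\<in>carrier Q_module. y \<oplus>\<^bsub>Q_module\<^esub> x = \<zero>\<^bsub>Q_module\<^esub>"
      by (intro bexI[of _ "- x"]) (auto simp: Q_module_def)
  qed (auto simp: Q_module_def)
qed (auto simp: Q_module_def algebra_simps cring_Zloc)

lemma module_Zloc_seq: "module (Zloc p) (seq_module (Zloc p))"
  by (intro module_seq_module cring_Zloc)

lemma module_C_mod: "module (Zloc p) (C_mod p k n)"
  unfolding C_mod_def Let_def
  by (auto intro!: module_direct_sum module_zero_part module_Q_module module_Zloc_seq)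

text \<open>The maps \<open>C_diff\<close> do define a complex of modules as soon as \<open>r\<close> is a p-local unit.\<close>

lemma cochain_complex_C:
  assumes r: "coprime r (int p)"
  shows "cochain_complex (Zloc p) (C_mod p k) (C_diff p r k)"
proof (rule cochain_complex.intro)
  fix n
  define e where "e = (2 * int p - 2) * k"
  consider "n = e - 2" | "n = e - 1" | "n = e" | "n = e + 1" | "n = e + 2"
    | "n \<notin> {e - 2, e - 1, e, e + 1, e + 2}"
    by blast
  note cases = this
  note C = C_mod_def[of p k, folded e_def, unfolded Let_def]
  note D = C_diff_def[of p r k, folded e_def, unfolded Let_def]
  note defs = direct_sum_def seq_module_def zero_part_def Q_module_def mod_hom_def Pi_iff
  show "module (Zloc p) (C_mod p k n)"
    by (rule module_C_mod)
  have up: "Psi_upper p r k a m \<in> carrier (Zloc p)" if "\<forall>m. a m \<in> carrier (Zloc p)" for a m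
    using that Zloc_powi[OF r] by (auto simp: Psi_upper_def)
  have low: "Psi_lower p k a m \<in> carrier (Zloc p)" if "\<forall>m. a m \<in> carrier (Zloc p)" for a m
    using that by (auto simp: Psi_lower_def)
  have hom: "Psi_upper p r k (\<lambda>m. a m + b m) = (\<lambda>m. Psi_upper p r k a m + Psi_upper p r k b m)"
    "Psi_upper p r k (\<lambda>m. c * a m) = (\<lambda>m. c * Psi_upper p r k a m)"
    "Psi_lower p k (\<lambda>m. a m + b m) = (\<lambda>m. Psi_lower p k a m + Psi_lower p k b m)"
    "Psi_lower p k (\<lambda>m. c * a m) = (\<lambda>m. c * Psi_lower p k a m)" for a b c
    by (auto simp: Psi_upper_def Psi_lower_def fun_eq_iff algebra_simps)
  have zero: "Psi_upper p r k (\<lambda>m. 0) = (\<lambda>m. 0)" "Psi_lower p k (\<lambda>m. 0) = (\<lambda>m. 0)"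
    by (auto simp: Psi_upper_def Psi_lower_def fun_eq_iff)
  have comm: "Psi_lower p k (Psi_upper p r k a) = Psi_upper p r k (Psi_lower p k a)" for a
    by (auto simp: Psi_upper_def Psi_lower_def fun_eq_iff algebra_simps)
  show "C_diff p r k n \<in> mod_hom (Zloc p) (C_mod p k n) (C_mod p k (n + 1))"
    by (rule cases; simp add: C D; simp add: defs up low hom zero; auto simp: algebra_simps)
  fix x assume "x \<in> carrier (C_mod p k n)"
  then show "C_diff p r k (n + 1) (C_diff p r k n x) = \<zero>\<^bsub>C_mod p k (n + 2)\<^esub>"
    by (rule_tac cases; simp add: C D; simp add: defs zero comm split: prod.splits)
qed

lemma Zmod_ex1:
  assumes "x \<in> carrier (Zloc p)"
  shows "\<exists>!z. z \<in> {0..int p ^ n - 1} \<and>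
    (\<exists>y\<in>carrier (Zloc p). x * of_int c - of_int z = of_int (int p ^ n) * y)"
proof -
  from assms obtain a b where ab: "\<not> int p dvd b" "b \<noteq> 0" "x = of_int a / of_int b"
    by (elim ZlocE)
  have pos: "int p ^ n > 0" using p by (simp add: prime_gt_0_nat)
  have cop: "coprime b (int p ^ n)"
    using prime_imp_coprime[OF prime_int ab(1)] by (simp add: coprime_commute)
  have key: "(\<exists>y\<in>carrier (Zloc p). x * of_int c - of_int z = of_int (int p ^ n) * y) \<longleftrightarrow>
      int p ^ n dvd a * c - b * z" (is "?L = ?R") for z
  proof
    assume ?L
    then obtain a' b' where y: "\<not> int p dvd b'" "b' \<noteq> 0"
        "x * of_int c - of_int z = of_int (int p ^ n) * (of_int a' / of_int b' :: rat)"
      by (metis ZlocE)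
    then have "(of_int ((a * c - b * z) * b') :: rat) = of_int (int p ^ n * (a' * b))"
      using ab by (simp add: field_simps)
    then have "(a * c - b * z) * b' = int p ^ n * (a' * b)"
      unfolding of_int_eq_iff .
    then have "int p ^ n dvd (a * c - b * z) * b'" by simp
    moreover have "coprime (int p ^ n) b'"
      using prime_imp_coprime[OF prime_int y(1)] by simp
    ultimately show ?R by (simp add: coprime_dvd_mult_left_iff)
  next
    assume ?R
    then obtain q where q: "a * c - b * z = int p ^ n * q" by blast
    have "(of_int (a * c - b * z) :: rat) = of_int (int p ^ n * q)" using q by simp
    then have "x * of_int c - of_int z = of_int (int p ^ n) * (of_int q / of_int b :: rat)"
      unfolding ab(3) using ab(2) by (simp add: field_simps)
    with ZlocI[OF ab(1)] show ?L by blast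
  qed
  obtain b' where b': "[b * b' = 1] (mod int p ^ n)"
    using cong_solve_coprime_int[OF cop] by blast
  have R: "int p ^ n dvd a * c - b * z \<longleftrightarrow> [z = b' * (a * c)] (mod int p ^ n)" for z
  proof -
    have "int p ^ n dvd a * c - b * z \<longleftrightarrow> [b * z = a * c] (mod int p ^ n)"
      by (metis cong_iff_dvd_diff cong_sym)
    also have "\<dots> \<longleftrightarrow> [b * z = b * (b' * (a * c))] (mod int p ^ n)"
      using cong_scalar_right[OF b', of "a * c"] by (simp add: mult.assoc) (meson cong_sym cong_trans)
    also have "\<dots> \<longleftrightarrow> [z = b' * (a * c)] (mod int p ^ n)"
      using cong_mult_lcancel[OF cop] .
    finally show ?thesis .
  qed
  show ?thesis
    unfolding key R
    by (rule ex1I[of _ "(b' * (a * c)) mod int p ^ n"]) (use pos in \<open>auto simp: cong_def simp del: zero_less_power_eq\<close>)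
qed

lemma module_Zmod_module:
  assumes "n > 0"
  shows "module (Zloc p) (Zmod_module p n)"
proof -
  define M where "M = Zmod_module p n"
  define P where "P = int p ^ n"
  define sm where "sm = (\<lambda>x c. x \<odot>\<^bsub>M\<^esub> c)"
  define rel where "rel = (\<lambda>x c z. \<exists>y\<in>carrier (Zloc p). x * of_int c - of_int z = of_int P * y)"
  have P1: "P > 1"
    using assms p unfolding P_def by (metis of_nat_1 of_nat_less_iff of_nat_power one_less_power prime_gt_1_nat)
  interpret residues P "residue_ring P"
    by unfold_locales (rule P1)
  have M: "carrier M = {0..P - 1}" "\<And>x y. x \<oplus>\<^bsub>M\<^esub> y = (x + y) mod P" "\<zero>\<^bsub>M\<^esub> = 0"
    by (simp_all add: M_def Zmod_module_def ring.defs module.defs residue_ring_def P_def)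
  have sm_eq: "sm x c = (THE z. z \<in> {0..P - 1} \<and> rel x c z)" for x c
    by (simp add: sm_def M_def Zmod_module_def ring.defs module.defs residue_ring_def P_def rel_def)
  have ex1: "\<exists>!z. z \<in> {0..P - 1} \<and> rel x c z" if "x \<in> carrier (Zloc p)" for x c
    using Zmod_ex1[OF that] by (simp add: P_def rel_def)
  have smD: "sm x c \<in> {0..P - 1}" "rel x c (sm x c)" if "x \<in> carrier (Zloc p)" for x c
    using theI'[OF ex1[OF that, of c]] by (simp_all add: sm_eq)
  have smI: "sm x c = z" if "x \<in> carrier (Zloc p)" "z \<in> {0..P - 1}" "rel x c z" for x c z
    unfolding sm_eq using that by (intro the1_equality ex1) auto
  have rel_trans: "rel x c z'" if "rel x c z" "[z = z'] (mod P)" for x c z z'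
  proof -
    from that(1) obtain y where y: "y \<in> carrier (Zloc p)" "x * of_int c - of_int z = of_int P * y"
      by (auto simp: rel_def)
    from that(2) obtain q where "z = z' + P * q"
      by (metis cong_iff_lin cong_sym)
    then have "x * of_int c - of_int z' = of_int P * (y + of_int q)"
      using y(2) by (simp add: algebra_simps)
    with y(1) show ?thesis unfolding rel_def by (intro bexI[of _ "y + of_int q"]) auto
  qed
  have smI': "sm x c = z mod P" if "x \<in> carrier (Zloc p)" "rel x c z" for x c z
    using that P1 by (intro smI rel_trans[OF that(2)]) auto
  have relI: "rel x c z" if "y \<in> carrier (Zloc p)" "x * of_int c - of_int z = of_int P * y" for x c y z
    using that unfolding rel_def by blast
  have relE: "\<exists>y\<in>carrier (Zloc p). of_int z = x * of_int c - of_int P * y" if "rel x c z" for x c z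
    using that unfolding rel_def by (auto simp: algebra_simps)
  have "abelian_group M"
  proof (rule abelian_groupI)
    fix x assume "x \<in> carrier M"
    then show "\<exists>y\<in>carrier M. y \<oplus>\<^bsub>M\<^esub> x = \<zero>\<^bsub>M\<^esub>"
      using P1 by (intro bexI[of _ "(- x) mod P"]) (auto simp: M mod_simps)
  qed (use P1 in \<open>auto simp: M mod_simps add_ac\<close>)
  then have "module (Zloc p) M"
  proof (rule moduleI[OF cring_Zloc], fold sm_def, unfold M Zloc_simps)
    fix a b x assume a: "a \<in> carrier (Zloc p)" and b: "b \<in> carrier (Zloc p)" and "x \<in> {0..P - 1}"
    obtain y where y: "y \<in> carrier (Zloc p)" "of_int (sm a x) = a * of_int x - of_int P * y"
      using relE[OF smD(2)[OF a]] by blast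
    obtain y' where y': "y' \<in> carrier (Zloc p)" "of_int (sm b x) = b * of_int x - of_int P * y'"
      using relE[OF smD(2)[OF b]] by blast
    show "sm (a + b) x = (sm a x + sm b x) mod P"
      using a b y y' by (intro smI' relI[of "y + y'"]) (auto simp: algebra_simps)
    obtain y'' where y'': "y'' \<in> carrier (Zloc p)"
        "of_int (sm a (sm b x)) = a * of_int (sm b x) - of_int P * y''"
      using relE[OF smD(2)[OF a]] by blast
    have "a * b * of_int x - of_int (sm a (sm b x)) = of_int P * (a * y' + y'')"
      unfolding y''(2) y'(2) by (simp add: algebra_simps)
    then show "sm (a * b) x = sm a (sm b x)"
      using a b smD(1)[OF a] y'(1) y''(1) by (intro smI relI[of "a * y' + y''"]) auto
  next
    fix a x y assume a: "a \<in> carrier (Zloc p)" and "x \<in> {0..P - 1}" "y \<in> {0..P - 1}"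
    obtain u where u: "u \<in> carrier (Zloc p)" "of_int (sm a x) = a * of_int x - of_int P * u"
      using relE[OF smD(2)[OF a]] by blast
    obtain v where v: "v \<in> carrier (Zloc p)" "of_int (sm a y) = a * of_int y - of_int P * v"
      using relE[OF smD(2)[OF a]] by blast
    have "x + y = (x + y) mod P + P * ((x + y) div P)"
      by simp
    then have *: "(of_int x + of_int y :: rat) =
        of_int ((x + y) mod P) + of_int P * of_int ((x + y) div P)"
      by (metis of_int_add of_int_mult)
    have eq: "a * of_int ((x + y) mod P) - of_int (sm a x + sm a y) =
        of_int P * (u + v - a * of_int ((x + y) div P))"
      using u(2) v(2) arg_cong[OF *, of "\<lambda>t. a * t"] by (simp add: algebra_simps)
    show "sm a ((x + y) mod P) = (sm a x + sm a y) mod P"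
      by (rule smI'[OF a relI[OF _ eq]]) (use a u(1) v(1) in auto)
  next
    fix a x assume "a \<in> carrier (Zloc p)" "x \<in> {0..P - 1}"
    then show "sm a x \<in> {0..P - 1}" using smD by blast
  next
    fix x assume "x \<in> {0..P - 1}"
    then show "sm 1 x = x"
      by (intro smI relI[of 0]) auto
  qed
  then show ?thesis unfolding M_def .
qed

lemma coprime_generator:
  assumes "generate (units_of (residue_ring (int p ^ 2))) {r mod int p ^ 2}
    = carrier (units_of (residue_ring (int p ^ 2)))"
  shows "coprime r (int p)"
proof -
  have "int p ^ 2 > 1"
    using p by (metis of_nat_1 of_nat_less_iff of_nat_power one_less_power prime_gt_1_nat pos2)
  then interpret residues "int p ^ 2" "residue_ring (int p ^ 2)"
    by unfold_locales
  have "r mod int p ^ 2 \<in> carrier (units_of (residue_ring (int p ^ 2)))"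
    unfolding assms[symmetric] by (rule generate.incl) simp
  then have "coprime (r mod int p ^ 2) (int p ^ 2)"
    by (simp add: units_of_def res_units_eq)
  then have "coprime r (int p ^ 2)"
    using p by (subst (asm) coprime_mod_left_iff) auto
  then show ?thesis
    by simp
qed

end

end

theory Submission
  imports Defs
begin

text \<open>
  Write \<open>n = \<nu>(k) + 1\<close>, \<open>e = (2p - 2)k\<close> and \<open>c\<^sub>m = r\<^bsup>s(m)\<^esup> - 1 + p\<^sup>n\<close>. Since \<open>\<Psi>\<^sub>*\<close> is
  multiplication by \<open>p\<^sup>n\<close>, which is injective on sequences of rational numbers, everything reduces
  to the behaviour of \<open>\<Psi>\<^sup>*\<close> modulo \<open>p\<^sup>n\<close>:

  \<^item> The cohomology in degree \<open>e - 1\<close> vanishes because \<open>\<Psi>\<^sub>*\<close> is injective, and in degree \<open>e + 2\<close>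
    because \<open>\<rat>\<close> is divisible.
  \<^item> A cocycle of degree \<open>e\<close> is a pair with \<open>p\<^sup>n a = \<Psi>\<^sup>* b\<close>. If \<open>b = p\<^sup>n u\<close>, then cancelling \<open>p\<^sup>n\<close>
    gives \<open>a = \<Psi>\<^sup>* u\<close>, so the pair is the coboundary of \<open>u\<close>. Hence the cohomology in degree \<open>e\<close>
    vanishes if \<open>\<Psi>\<^sup>*\<close> is injective modulo \<open>p\<^sup>n\<close>.
  \<^item> The cohomology in degree \<open>e + 1\<close> is the cokernel of \<open>\<Psi>\<^sup>*\<close> on sequences modulo \<open>p\<^sup>n\<close>; the
    summand \<open>\<rat>\<close> contains no cocycle other than \<open>0\<close>.

  Modulo \<open>p\<^sup>n\<close>, the zeroth term of \<open>\<Psi>\<^sup>* b\<close> is \<open>0\<close>, and the later ones are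
  \<open>(\<Psi>\<^sup>* b)\<^bsub>j+1\<^esub> = b\<^sub>j + c\<^bsub>j+1\<^esub> b\<^bsub>j+1\<^esub> = ((1 - T) b)\<^sub>j\<close> for the operator \<open>(T b)\<^sub>j = - c\<^bsub>j+1\<^esub> b\<^bsub>j+1\<^esub>\<close>. By Fermat's
  little theorem \<open>p\<close> divides \<open>c\<^sub>m\<close> whenever \<open>p - 1\<close> divides \<open>s(m)\<close>, which happens at least once
  among any \<open>2(p - 1)\<close> consecutive indices. Therefore \<open>T\<close> is nilpotent modulo \<open>p\<^sup>n\<close>
  (\<open>backstep_nilpotent\<close>), and \<open>1 - T\<close> is bijective there with a geometric sum as inverse. So \<open>\<Psi>\<^sup>*\<close>
  is injective modulo \<open>p\<^sup>n\<close> (\<open>Psi_upper_inj_mod\<close>), and its image consists of all sequences with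
  zeroth term \<open>0\<close> (\<open>Psi_upper_surj_mod\<close>). The cokernel is thus \<open>\<int>/p\<^sup>n\<close>, through the class of the
  zeroth term.
\<close>

section \<open>Recognizing cohomology modules\<close>

lemma quot_module_kernel_isomorphic:
  assumes M: "module R M" and N: "module R N" and g: "g \<in> mod_hom R M N"
    and onto: "g ` carrier M = carrier N"
  shows "module_isomorphic R (quot_module M (a_kernel M N g)) N"
proof -
  let ?B = "a_kernel M N g"
  let ?f = "\<lambda>X. the_elem (g ` X)"
  interpret M: module R M by fact
  interpret N: module R N by fact
  interpret g: abelian_group_hom M N g by (rule mod_hom_abelian_group_hom[OF M N g])
  have B: "submodule ?B R M" by (rule submodule_a_kernel[OF M N g])
  interpret B: abelian_subgroup ?B M by (rule g.abelian_subgroup_a_kernel)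
  have iso: "?f \<in> iso (M A_Mod ?B) (add_monoid N)"
    by (rule g.A_FactGroup_iso_set[OF onto])
  have carr: "carrier (M A_Mod ?B) = carrier (quot_module M ?B)"
    by (simp add: A_FactGroup_def' quot_module_def)
  have rep: "?f (?B +>\<^bsub>M\<^esub> x) = g x" if "x \<in> carrier M" for x
  proof -
    have "g y = g x" if "y \<in> ?B +>\<^bsub>M\<^esub> x" for y
    proof -
      from that obtain h where "h \<in> carrier M" "g h = \<zero>\<^bsub>N\<^esub>" "y = h \<oplus>\<^bsub>M\<^esub> x"
        unfolding a_r_coset_def' a_kernel_def' by blast
      then show ?thesis
        using \<open>x \<in> carrier M\<close> by simp
    qed
    then have "g ` (?B +>\<^bsub>M\<^esub> x) = {g x}"
      using B.a_rcos_self[OF that] by blast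
    then show ?thesis by simp
  qed
  have "?f \<in> mod_hom R (quot_module M ?B) N"
    unfolding mod_hom_def
  proof (intro CollectI conjI ballI)
    show "?f \<in> carrier (quot_module M ?B) \<rightarrow> carrier N"
      using iso carr by (auto simp: iso_def hom_def)
  next
    fix X Y assume "X \<in> carrier (quot_module M ?B)" "Y \<in> carrier (quot_module M ?B)"
    then show "?f (X \<oplus>\<^bsub>quot_module M ?B\<^esub> Y) = ?f X \<oplus>\<^bsub>N\<^esub> ?f Y"
      using iso unfolding carr[symmetric] by (auto simp: iso_def hom_def quot_module_def)
  next
    fix a X assume a: "a \<in> carrier R" and "X \<in> carrier (quot_module M ?B)"
    then obtain x where x: "x \<in> carrier M" "X = ?B +>\<^bsub>M\<^esub> x"
      by (auto simp: quot_module_def A_RCOSETS_def')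
    have "g (a \<odot>\<^bsub>M\<^esub> x) = a \<odot>\<^bsub>N\<^esub> g x"
      using g a x(1) by (auto simp: mod_hom_def)
    then show "?f (a \<odot>\<^bsub>quot_module M ?B\<^esub> X) = a \<odot>\<^bsub>N\<^esub> ?f X"
      using a x by (simp add: quot_module_smult[OF M B] rep)
  qed
  moreover have "bij_betw ?f (carrier (quot_module M ?B)) (carrier N)"
    using iso carr by (simp add: iso_def)
  ultimately show ?thesis
    unfolding module_isomorphic_def by blast
qed

lemma quot_module_self_zero:
  assumes "module R M"
  shows "is_zero_module (quot_module M (carrier M))"
proof -
  interpret module R M by fact
  have "carrier M +>\<^bsub>M\<^esub> x = carrier M" if "x \<in> carrier M" for x
    using that M.add.subgroup_self by (intro M.a_coset_join2)
  then have "a_rcosets\<^bsub>M\<^esub> (carrier M) = {carrier M}"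
    using M.zero_closed unfolding A_RCOSETS_def' by blast
  then show ?thesis
    by (simp add: is_zero_module_def quot_module_def)
qed

context cochain_complex
begin

lemma module_cocycles: "module R ((C n)\<lparr>carrier := a_kernel (C n) (C (n + 1)) (d n)\<rparr>)"
  by (intro submodule.submodule_is_module[OF submodule_a_kernel] module d_hom)

lemma coboundaries_subset_cocycles:
  "d (n - 1) ` carrier (C (n - 1)) \<subseteq> {x \<in> carrier (C n). d n x = \<zero>\<^bsub>C (n + 1)\<^esub>}"
proof -
  have deg: "n - 1 + 1 = n" "n - 1 + 2 = n + 1"
    by simp_all
  show ?thesis
    using d_d[of _ "n - 1"] d_hom[of "n - 1"] unfolding deg mod_hom_def by blast
qed

text \<open>
  The first isomorphism theorem for the module of cocycles. Taking \<open>g\<close> on all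
  cochains lets it be given by a formula and spares a module structure on the cocycles in the
  hypotheses.
\<close>

lemma cohomology_isomorphicI:
  assumes N: "module R N"
    and g: "g \<in> mod_hom R (C n) N"
    and onto: "\<And>y. y \<in> carrier N \<Longrightarrow> \<exists>x\<in>carrier (C n). d n x = \<zero>\<^bsub>C (n + 1)\<^esub> \<and> g x = y"
    and boundary: "\<And>x. x \<in> carrier (C n) \<Longrightarrow> d n x = \<zero>\<^bsub>C (n + 1)\<^esub> \<Longrightarrow>
      g x = \<zero>\<^bsub>N\<^esub> \<longleftrightarrow> x \<in> d (n - 1) ` carrier (C (n - 1))"
  shows "module_isomorphic R (cohomology C d n) N"
proof -
  let ?K = "(C n)\<lparr>carrier := a_kernel (C n) (C (n + 1)) (d n)\<rparr>"
  have carr: "carrier ?K = {x \<in> carrier (C n). d n x = \<zero>\<^bsub>C (n + 1)\<^esub>}"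
    by (simp add: a_kernel_def')
  have "a_kernel ?K N g = d (n - 1) ` carrier (C (n - 1))"
    using boundary coboundaries_subset_cocycles[of n] unfolding a_kernel_def' carr by auto
  moreover have "g \<in> mod_hom R ?K N"
    using g by (auto simp: mod_hom_def a_kernel_def')
  moreover have "g ` carrier ?K = carrier N"
    using g onto unfolding carr by (fastforce simp: mod_hom_def)
  ultimately show ?thesis
    using quot_module_kernel_isomorphic[OF module_cocycles N, of g n]
    by (simp add: cohomology_def)
qed

lemma cohomology_zeroI:
  assumes "\<And>x. x \<in> carrier (C n) \<Longrightarrow> d n x = \<zero>\<^bsub>C (n + 1)\<^esub> \<Longrightarrow> x \<in> d (n - 1) ` carrier (C (n - 1))"
  shows "is_zero_module (cohomology C d n)"
proof -
  let ?K = "(C n)\<lparr>carrier := a_kernel (C n) (C (n + 1)) (d n)\<rparr>"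
  have carr: "carrier ?K = {x \<in> carrier (C n). d n x = \<zero>\<^bsub>C (n + 1)\<^esub>}"
    by (simp add: a_kernel_def')
  have B: "d (n - 1) ` carrier (C (n - 1)) = carrier ?K"
  proof
    show "d (n - 1) ` carrier (C (n - 1)) \<subseteq> carrier ?K"
      unfolding carr by (rule coboundaries_subset_cocycles)
    show "carrier ?K \<subseteq> d (n - 1) ` carrier (C (n - 1))"
    proof
      fix x assume "x \<in> carrier ?K"
      then have "x \<in> carrier (C n)" "d n x = \<zero>\<^bsub>C (n + 1)\<^esub>"
        by (simp_all add: carr)
      then show "x \<in> d (n - 1) ` carrier (C (n - 1))"
        by (rule assms)
    qed
  qed
  show ?thesis
    unfolding cohomology_def B by (rule quot_module_self_zero[OF module_cocycles])
qed

end


section \<open>Divisibility by powers of \<open>p\<close> in the p-local integers\<close>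

definition p_multiples :: "nat \<Rightarrow> nat \<Rightarrow> rat set"
  where "p_multiples p n = (\<lambda>y. of_nat p ^ n * y) ` carrier (Zloc p)"

context
  fixes p :: nat
  assumes p: "prime p"
begin

lemma p_multiplesI: "y \<in> carrier (Zloc p) \<Longrightarrow> of_nat p ^ n * y \<in> p_multiples p n"
  unfolding p_multiples_def by (rule imageI)

lemma p_multiples_0: "p_multiples p 0 = carrier (Zloc p)"
  by (simp add: p_multiples_def)

lemma zero_in_p_multiples: "0 \<in> p_multiples p n"
  using p_multiplesI[of 0 n] p by simp

lemma p_multiples_add:
  assumes "x \<in> p_multiples p n" "y \<in> p_multiples p n"
  shows "x + y \<in> p_multiples p n"
  using assms p by (auto simp: p_multiples_def simp flip: distrib_left)

lemma p_multiples_mult: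
  assumes "x \<in> p_multiples p m" "y \<in> p_multiples p n"
  shows "x * y \<in> p_multiples p (m + n)"
proof -
  from assms obtain u v where "u \<in> carrier (Zloc p)" "x = of_nat p ^ m * u"
    "v \<in> carrier (Zloc p)" "y = of_nat p ^ n * v"
    by (auto simp: p_multiples_def)
  then show ?thesis
    using p_multiplesI[of "u * v" "m + n"] p by (simp add: power_add mult_ac)
qed

lemma p_multiples_smult:
  "x \<in> carrier (Zloc p) \<Longrightarrow> y \<in> p_multiples p n \<Longrightarrow> x * y \<in> p_multiples p n"
  using p_multiples_mult[of x 0 y n] by (simp add: p_multiples_0)

lemma p_multiples_minus: "x \<in> p_multiples p n \<Longrightarrow> - x \<in> p_multiples p n"
  using p_multiples_smult[of "-1" x n] p by simp

lemma seq_divide_p_power: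
  assumes "\<And>j. a j \<in> p_multiples p n"
  obtains x where "\<And>j. x j \<in> carrier (Zloc p)" "\<And>j. a j = of_nat p ^ n * x j"
proof -
  have "\<forall>j. \<exists>y. y \<in> carrier (Zloc p) \<and> a j = of_nat p ^ n * y"
    using assms by (force simp: p_multiples_def)
  with that show thesis by metis
qed

text \<open>
  Reduction modulo \<open>p\<^sup>n\<close> on the p-local integers is scalar multiplication applied to the class
  of \<open>1\<close>. In this form its linearity comes from the module axioms, while its kernel (\<open>z = 0\<close>) and its
  surjectivity (\<open>x = z\<close>) can both be read off here.
\<close>

lemma Zmod_smult_one_eq_iff:
  assumes x: "x \<in> carrier (Zloc p)" and z: "z \<in> carrier (Zmod_module p n)"
  shows "x \<odot>\<^bsub>Zmod_module p n\<^esub> 1 = z \<longleftrightarrow> x - of_int z \<in> p_multiples p n"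
proof -
  define rel where "rel = (\<lambda>z. z \<in> {0..int p ^ n - 1} \<and>
    (\<exists>y\<in>carrier (Zloc p). x * of_int 1 - of_int z = of_int (int p ^ n) * y))"
  have ex1: "\<exists>!z. rel z"
    unfolding rel_def by (rule Zmod_ex1[OF p x])
  have "x \<odot>\<^bsub>Zmod_module p n\<^esub> 1 = (THE z. rel z)"
    by (simp add: Zmod_module_def ring.defs module.defs residue_ring_def rel_def)
  also have "\<dots> = z \<longleftrightarrow> rel z"
    using theI'[OF ex1] the1_equality[OF ex1] by blast
  also have "\<dots> \<longleftrightarrow> x - of_int z \<in> p_multiples p n"
    using z by (auto simp: rel_def p_multiples_def Zmod_module_def ring.defs module.defs residue_ring_def)
  finally show ?thesis .
qed

end


section \<open>A nilpotent operator on sequences modulo a power of \<open>p\<close>\<close>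

text \<open>
  Up to sign a weighted backward shift, the sign being chosen such that \<open>\<Psi>\<^sup>*\<close>, followed by
  dropping the zeroth term, is the identity minus this operator.
\<close>

definition backstep :: "(nat \<Rightarrow> rat) \<Rightarrow> (nat \<Rightarrow> rat) \<Rightarrow> nat \<Rightarrow> rat"
  where "backstep c b j = - c (Suc j) * b (Suc j)"

lemma funpow_backstep_Suc:
  "(backstep c ^^ Suc i) b j = - c (Suc j) * (backstep c ^^ i) b (Suc j)"
  unfolding funpow.simps o_apply by (rule backstep_def)

context
  fixes p q :: nat and c :: "nat \<Rightarrow> rat"
  assumes p: "prime p"
    and c: "\<And>m. c m \<in> carrier (Zloc p)"
    and c_window: "\<And>j. \<exists>m\<in>{j<..j + q}. c m \<in> p_multiples p 1"
begin

lemma backstep_p_multiples: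
  assumes "\<And>j. b j \<in> p_multiples p n"
  shows "(backstep c ^^ i) b j \<in> p_multiples p n"
proof (induction i arbitrary: j)
  case (Suc i)
  then show ?case
    using p_multiples_smult[OF p Zloc_minus[OF p c[of "Suc j"]] Suc[of "Suc j"]]
    by (simp only: funpow_backstep_Suc)
qed (use assms in simp)

text \<open>
  Unfolding the powers of the operator, \<open>(T\<^sup>i b)\<^sub>j\<close> is \<open>\<plusminus> c\<^bsub>j+1\<^esub> \<cdots> c\<^bsub>j+i\<^esub> b\<^bsub>j+i\<^esub>\<close>: the value \<open>b\<^bsub>j+i\<^esub>\<close>
  contributes \<open>p\<^sup>n\<close>, and the factor \<open>c\<^sub>m\<close> contributes one more \<open>p\<close>.
\<close>

lemma backstep_gains_p_factor:
  assumes b: "\<And>j. b j \<in> p_multiples p n"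
  shows "m \<in> {j<..j + i} \<Longrightarrow> c m \<in> p_multiples p 1 \<Longrightarrow> (backstep c ^^ i) b j \<in> p_multiples p (Suc n)"
proof (induction i arbitrary: j)
  case (Suc i)
  show ?case
  proof (cases "m = Suc j")
    case True
    have "(- c (Suc j)) * (backstep c ^^ i) b (Suc j) \<in> p_multiples p (1 + n)"
      using Suc.prems True by (intro p_multiples_mult[OF p] p_multiples_minus[OF p] backstep_p_multiples b) auto
    then show ?thesis by (simp only: funpow_backstep_Suc plus_1_eq_Suc)
  next
    case False
    then have "(backstep c ^^ i) b (Suc j) \<in> p_multiples p (Suc n)"
      using Suc.prems by (intro Suc.IH) auto
    with Zloc_minus[OF p c] show ?thesis
      unfolding funpow_backstep_Suc by (rule p_multiples_smult[OF p])
  qed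
qed simp

text \<open>
  Every \<open>q\<close> steps meet a weight divisible by \<open>p\<close> and gain a factor \<open>p\<close>. That the window length \<open>q\<close>
  does not depend on \<open>j\<close> yields one exponent for the whole sequence, although the sequence is infinite.
\<close>

lemma backstep_nilpotent:
  assumes "\<And>j. b j \<in> carrier (Zloc p)"
  shows "(backstep c ^^ (q * n)) b j \<in> p_multiples p n"
proof (induction n arbitrary: j)
  case (Suc n)
  obtain m where "m \<in> {j<..j + q}" "c m \<in> p_multiples p 1"
    using c_window by blast
  then have "(backstep c ^^ q) ((backstep c ^^ (q * n)) b) j \<in> p_multiples p (Suc n)"
    using Suc by (rule backstep_gains_p_factor[rotated])
  then show ?case by (simp add: funpow_add)
qed (use assms in \<open>simp add: p_multiples_0[OF p]\<close>)

text \<open>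
  If \<open>b\<close> is congruent to \<open>T b\<close>, then it is congruent to all \<open>T\<^sup>i b\<close>, and a high power of \<open>T\<close> vanishes
  modulo \<open>p\<^sup>n\<close>.
\<close>

lemma id_minus_backstep_inj:
  assumes b: "\<And>j. b j \<in> carrier (Zloc p)"
    and eq: "\<And>j. b j - backstep c b j \<in> p_multiples p n"
  shows "b j \<in> p_multiples p n"
proof -
  have "b j - (backstep c ^^ i) b j \<in> p_multiples p n" for i j
  proof (induction i arbitrary: j)
    case (Suc i)
    have "b j - (backstep c ^^ Suc i) b j =
        (b j - backstep c b j) + (- c (Suc j)) * (b (Suc j) - (backstep c ^^ i) b (Suc j))"
      unfolding funpow_backstep_Suc backstep_def by (simp add: algebra_simps)
    also have "\<dots> \<in> p_multiples p n"
      using c p by (intro p_multiples_add[OF p] eq p_multiples_smult[OF p] Suc Zloc_minus)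
    finally show ?case .
  qed (simp add: zero_in_p_multiples[OF p])
  from p_multiples_add[OF p this[of j "q * n"] backstep_nilpotent[of b n j, OF b]] show ?thesis by simp
qed

text \<open>
  The geometric sum \<open>(1 + T + \<dots> + T\<^bsup>L-1\<^esup>) y\<close> is a preimage of \<open>y\<close> up to the error \<open>T\<^sup>L y\<close>, which is
  zero modulo \<open>p\<^sup>n\<close> for \<open>L = q n\<close>.
\<close>

lemma id_minus_backstep_surj:
  assumes y: "\<And>j. y j \<in> carrier (Zloc p)"
  obtains b where "\<And>j. b j \<in> carrier (Zloc p)"
    "\<And>j. y j - (b j - backstep c b j) \<in> p_multiples p n"
proof
  define b where "b = (\<lambda>j. \<Sum>i<q * n. (backstep c ^^ i) y j)"
  have "(backstep c ^^ i) y j \<in> carrier (Zloc p)" for i j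
    using backstep_p_multiples[of y 0] y by (simp add: p_multiples_0[OF p])
  then have "(\<Sum>i<l. (backstep c ^^ i) y j) \<in> carrier (Zloc p)" for l j
    by (induction l) (use p in simp_all)
  then show "b j \<in> carrier (Zloc p)" for j
    unfolding b_def .
  have "b j - backstep c b j = y j - (backstep c ^^ (q * n)) y j" for j
  proof -
    have "b j - backstep c b j = (\<Sum>i<q * n. (backstep c ^^ i) y j - (backstep c ^^ Suc i) y j)"
      unfolding funpow_backstep_Suc backstep_def b_def sum_subtractf sum_distrib_left ..
    then show ?thesis
      using sum_lessThan_telescope'[of "\<lambda>i. (backstep c ^^ i) y j"] by simp
  qed
  then show "y j - (b j - backstep c b j) \<in> p_multiples p n" for j
    using backstep_nilpotent[OF y] by simp
qed

end


section \<open>The map \<open>\<Psi>\<^sup>*\<close> modulo \<open>p\<^bsup>\<nu>(k)+1\<^esup>\<close>\<close>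

definition Psi_coeff :: "nat \<Rightarrow> int \<Rightarrow> int \<Rightarrow> nat \<Rightarrow> rat"
  where "Psi_coeff p r k m = of_int r powi s_exp m - 1 + of_nat p ^ (multiplicity (int p) k + 1)"

lemma Psi_upper_Suc: "Psi_upper p r k b (Suc j) = b j - backstep (Psi_coeff p r k) b j"
  unfolding backstep_def by (simp add: Psi_upper_def Psi_coeff_def algebra_simps)

context
  fixes p :: nat and r k :: int
  assumes p: "prime p" and r: "coprime r (int p)"
begin

lemma Psi_coeff_Zloc: "Psi_coeff p r k m \<in> carrier (Zloc p)"
  using Zloc_powi[OF p r] p by (simp add: Psi_coeff_def)

text \<open>
  Fermat's little theorem makes \<open>r\<^bsup>s(m)\<^esup> - 1\<close> divisible by \<open>p\<close>, and the other summand \<open>p\<^bsup>\<nu>(k)+1\<^esup>\<close> has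
  a positive exponent.
\<close>

lemma Psi_coeff_p_multiple:
  assumes "s_exp m = int ((p - 1) * t)"
  shows "Psi_coeff p r k m \<in> p_multiples p 1"
proof -
  have "residues (int p)"
    using p prime_gt_1_nat by unfold_locales fastforce
  then have "[r ^ totient (nat (int p)) = 1] (mod int p)"
    using r by (rule residues.euler_theorem)
  then have "[r ^ (p - 1) = 1] (mod int p)"
    using p by (simp add: totient_prime)
  from cong_pow[OF this, of t] have "[r ^ ((p - 1) * t) = 1] (mod int p)"
    by (simp add: power_mult)
  then obtain u where u: "r ^ ((p - 1) * t) - 1 = int p * u"
    by (metis cong_iff_dvd_diff dvdE)
  have "Psi_coeff p r k m = of_int (r ^ ((p - 1) * t) - 1 + int p ^ (multiplicity (int p) k + 1))"
    unfolding Psi_coeff_def assms power_int_of_nat by simp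
  also have "\<dots> = of_nat p ^ 1 * of_int (u + int p ^ multiplicity (int p) k)"
    unfolding u by (simp add: algebra_simps)
  also have "\<dots> \<in> p_multiples p 1"
    using p by (intro p_multiplesI Zloc_of_int)
  finally show ?thesis .
qed

lemma Psi_coeff_window: "\<exists>m\<in>{j<..j + 2 * (p - 1)}. Psi_coeff p r k m \<in> p_multiples p 1"
proof -
  define q where "q = 2 * (p - 1)"
  \<comment> \<open>The index sought is \<open>q t - 1\<close>, odd because \<open>q\<close> is even, so that \<open>s(q t - 1) = q t / 2 = (p - 1) t\<close>.
    The multiple \<open>q t\<close> is the first one beyond \<open>j + 1\<close>, which puts \<open>q t - 1\<close> beyond \<open>j\<close>.\<close>
  define t where "t = Suc ((j + 1) div q)"
  have "q > 0"
    using prime_gt_1_nat[OF p] by (simp add: q_def)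
  then have t: "j + 1 < q * t" "q * t \<le> j + 1 + q"
    using dividend_less_times_div[of q "j + 1"] by (auto simp: t_def)
  have "q * t = 2 * ((p - 1) * t)"
    by (simp add: q_def)
  with t(1) have "q * t - 1 = 2 * ((p - 1) * t - 1) + 1" "(p - 1) * t \<ge> 1"
    by linarith+
  then have "s_exp (q * t - 1) = int ((p - 1) * t)"
    by (simp add: s_exp_def)
  then show ?thesis
    using Psi_coeff_p_multiple[of "q * t - 1" t] t unfolding q_def[symmetric]
    by (intro bexI[of _ "q * t - 1"]) auto
qed

lemma Psi_upper_inj_mod:
  assumes "\<And>j. b j \<in> carrier (Zloc p)" "\<And>j. Psi_upper p r k b (Suc j) \<in> p_multiples p n"
  shows "b j \<in> p_multiples p n"
  by (rule id_minus_backstep_inj[OF p Psi_coeff_Zloc Psi_coeff_window])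
    (use assms in \<open>auto simp: Psi_upper_Suc\<close>)

lemma Psi_upper_surj_mod:
  assumes "\<And>j. a j \<in> carrier (Zloc p)"
  obtains b where "\<And>j. b j \<in> carrier (Zloc p)"
    "\<And>j. a (Suc j) - Psi_upper p r k b (Suc j) \<in> p_multiples p n"
proof -
  obtain b where b: "\<And>j. b j \<in> carrier (Zloc p)"
    "\<And>j. a (Suc j) - (b j - backstep (Psi_coeff p r k) b j) \<in> p_multiples p n"
    using id_minus_backstep_surj[OF p Psi_coeff_Zloc Psi_coeff_window, of "\<lambda>j. a (Suc j)"] assms
    by metis
  show thesis
    by (rule that[of b]) (simp_all only: Psi_upper_Suc b)
qed

end


section \<open>The cohomology of the complex\<close>

context
  fixes p n :: nat and r k e :: int
  assumes p: "prime p" and r: "coprime r (int p)"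
    and n_def: "n = multiplicity (int p) k + 1" and e_def: "e = (2 * int p - 2) * k"
begin

interpretation cochain_complex "Zloc p" "C_mod p k" "C_diff p r k"
  by (rule cochain_complex_C[OF p r])

lemmas C_unfold = C_mod_def[of p k, folded e_def] C_diff_def[of p r k, folded n_def e_def]
  direct_sum_def seq_module_def zero_part_def Q_module_def Let_def

lemma Psi_lower_eq_mult: "Psi_lower p k a m = of_nat p ^ n * a m"
  by (simp add: Psi_lower_def n_def)

lemma Psi_upper_0: "Psi_upper p r k a 0 = of_nat p ^ n * a 0"
  by (simp add: Psi_upper_def n_def)

lemma p_pos: "p > 0"
  using p by (rule prime_gt_0_nat)

lemma cohomology_e_minus_1_zero: "is_zero_module (cohomology (C_mod p k) (C_diff p r k) (e - 1))"
proof (rule cohomology_zeroI)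
  fix x assume x: "x \<in> carrier (C_mod p k (e - 1))"
    "C_diff p r k (e - 1) x = \<zero>\<^bsub>C_mod p k (e - 1 + 1)\<^esub>"
  obtain a b t where abt: "x = (a, b, t)"
    by (cases x)
  have "Psi_lower p k a = (\<lambda>m. 0)" and x0: "b = (\<lambda>m. 0)" "t = 0"
    using x by (simp_all add: abt C_unfold)
  then have "of_nat p ^ n * a m = 0" for m
    by (metis Psi_lower_eq_mult)
  then have "a = (\<lambda>m. 0)"
    using p_pos by (simp add: fun_eq_iff)
  then show "x \<in> C_diff p r k (e - 1 - 1) ` carrier (C_mod p k (e - 1 - 1))"
    by (simp add: abt x0 C_unfold)
qed

lemma cohomology_e_zero: "is_zero_module (cohomology (C_mod p k) (C_diff p r k) e)"
proof (rule cohomology_zeroI)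
  fix x assume x: "x \<in> carrier (C_mod p k e)" "C_diff p r k e x = \<zero>\<^bsub>C_mod p k (e + 1)\<^esub>"
  obtain a b t where abt: "x = (a, b, t)"
    by (cases x)
  have t: "t = 0" and a: "\<And>m. a m \<in> carrier (Zloc p)" and b: "\<And>m. b m \<in> carrier (Zloc p)"
    and eq: "\<And>m. Psi_upper p r k b m = of_nat p ^ n * a m"
    using x by (simp_all add: abt C_unfold fun_eq_iff Psi_lower_eq_mult)
  have "Psi_upper p r k b (Suc j) \<in> p_multiples p n" for j
    unfolding eq by (intro p_multiplesI p a)
  with b have "b j \<in> p_multiples p n" for j
    by (rule Psi_upper_inj_mod[OF p r])
  then obtain u where u: "\<And>j. u j \<in> carrier (Zloc p)" "\<And>j. b j = of_nat p ^ n * u j"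
    using seq_divide_p_power[OF p] by blast
  then have bu: "b = Psi_lower p k u"
    by (simp add: Psi_lower_eq_mult fun_eq_iff)
  \<comment> \<open>\<open>\<Psi>\<^sup>*\<close> and \<open>\<Psi>\<^sub>*\<close> commute, so the factor \<open>p\<^sup>n\<close> cancels from \<open>p\<^sup>n a = \<Psi>\<^sup>* (p\<^sup>n u)\<close>.\<close>
  have "of_nat p ^ n * a m = of_nat p ^ n * Psi_upper p r k u m" for m
    unfolding eq[symmetric] by (simp add: Psi_upper_def u(2) distrib_left mult_ac)
  then have "a = Psi_upper p r k u"
    using p_pos by (simp add: fun_eq_iff)
  then have "x = C_diff p r k (e - 1) (u, \<lambda>m. 0, 0)"
    by (simp add: C_unfold abt bu t)
  moreover have "(u, \<lambda>m. 0, 0) \<in> carrier (C_mod p k (e - 1))"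
    using u(1) by (simp add: C_unfold)
  ultimately show "x \<in> C_diff p r k (e - 1) ` carrier (C_mod p k (e - 1))"
    by (rule image_eqI)
qed

lemma cohomology_e_plus_2_zero: "is_zero_module (cohomology (C_mod p k) (C_diff p r k) (e + 2))"
proof (rule cohomology_zeroI)
  fix x assume x: "x \<in> carrier (C_mod p k (e + 2))"
  obtain a b t where abt: "x = (a, b, t)"
    by (cases x)
  have "a = (\<lambda>m. 0)" "b = (\<lambda>m. 0)"
    using x by (simp_all add: abt C_unfold)
  then have "x = C_diff p r k (e + 2 - 1) (\<lambda>m. 0, \<lambda>m. 0, t / of_nat p ^ n)"
    using p_pos by (simp add: abt C_unfold)
  moreover have "(\<lambda>m. 0, \<lambda>m. 0, t / of_nat p ^ n) \<in> carrier (C_mod p k (e + 2 - 1))"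
    using p by (simp add: C_unfold)
  ultimately show "x \<in> C_diff p r k (e + 2 - 1) ` carrier (C_mod p k (e + 2 - 1))"
    by (rule image_eqI)
qed

text \<open>
  This computes the cokernel of \<open>\<Psi>\<^sup>*\<close> modulo \<open>p\<^sup>n\<close>. The zeroth term is the only obstruction: choosing
  \<open>b\<close> with \<open>\<Psi>\<^sup>* b\<close> congruent to \<open>- a\<close> from the first term on makes all terms of \<open>a + \<Psi>\<^sup>* b\<close> divisible by
  \<open>p\<^sup>n\<close>, hence \<open>a = \<Psi>\<^sub>* u - \<Psi>\<^sup>* b\<close> for some \<open>u\<close>.
\<close>

lemma coboundary_e_plus_1_iff:
  assumes a: "\<And>m. a m \<in> carrier (Zloc p)"
  shows "(a, \<lambda>m. 0, 0) \<in> C_diff p r k e ` carrier (C_mod p k e) \<longleftrightarrow> a 0 \<in> p_multiples p n"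
proof
  assume "(a, \<lambda>m. 0, 0) \<in> C_diff p r k e ` carrier (C_mod p k e)"
  then obtain w where w: "w \<in> carrier (C_mod p k e)" "(a, \<lambda>m. 0, 0) = C_diff p r k e w"
    by blast
  obtain u b t where w_eq: "w = (u, b, t)"
    by (cases w)
  have "a = (\<lambda>m. Psi_lower p k u m - Psi_upper p r k b m)" "u 0 \<in> carrier (Zloc p)"
      "b 0 \<in> carrier (Zloc p)"
    using w by (simp_all add: w_eq C_unfold)
  then have "a 0 = of_nat p ^ n * (u 0 - b 0)" "u 0 - b 0 \<in> carrier (Zloc p)"
    using p by (simp_all add: Psi_lower_eq_mult Psi_upper_0 right_diff_distrib)
  then show "a 0 \<in> p_multiples p n"
    using p_multiplesI[OF p] by metis
next
  assume a0: "a 0 \<in> p_multiples p n"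
  obtain b where b: "\<And>j. b j \<in> carrier (Zloc p)"
    "\<And>j. - a (Suc j) - Psi_upper p r k b (Suc j) \<in> p_multiples p n"
    using Psi_upper_surj_mod[OF p r, of "\<lambda>j. - a j" k n] Zloc_minus[OF p a] by metis
  have "a j + Psi_upper p r k b j \<in> p_multiples p n" for j
  proof (cases j)
    case 0
    show ?thesis
      using p_multiples_add[OF p a0 p_multiplesI[OF p b(1)]] by (simp add: 0 Psi_upper_0)
  next
    case (Suc i)
    then show ?thesis
      using p_multiples_minus[OF p b(2)[of i]] by (simp add: add.commute)
  qed
  then obtain u where u: "\<And>j. u j \<in> carrier (Zloc p)"
      "\<And>j. a j + Psi_upper p r k b j = of_nat p ^ n * u j"
    using seq_divide_p_power[OF p, of "\<lambda>j. a j + Psi_upper p r k b j" n] by blast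
  have "a j = Psi_lower p k u j - Psi_upper p r k b j" for j
    using u(2)[of j] by (simp add: Psi_lower_eq_mult)
  then have "(a, \<lambda>m. 0, 0) = C_diff p r k e (u, b, 0)"
    by (simp add: C_unfold fun_eq_iff)
  moreover have "(u, b, 0) \<in> carrier (C_mod p k e)"
    using u(1) b(1) by (simp add: C_unfold)
  ultimately show "(a, \<lambda>m. 0, 0) \<in> C_diff p r k e ` carrier (C_mod p k e)"
    by (rule image_eqI)
qed

lemma cohomology_e_plus_1_isomorphic:
  "module_isomorphic (Zloc p) (cohomology (C_mod p k) (C_diff p r k) (e + 1)) (Zmod_module p n)"
proof -
  let ?Z = "Zmod_module p n"
  let ?g = "\<lambda>x :: cochain. fst x 0 \<odot>\<^bsub>?Z\<^esub> 1"
  have "n > 0"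
    by (simp add: n_def)
  then interpret Z: module "Zloc p" ?Z
    by (rule module_Zmod_module[OF p])
  have "int p ^ n > 1"
    using prime_gt_1_nat[OF p] \<open>n > 0\<close> by (intro one_less_power) auto
  then have one: "1 \<in> carrier ?Z" and zero: "\<zero>\<^bsub>?Z\<^esub> = 0"
    by (simp_all add: Zmod_module_def ring.defs module.defs residue_ring_def)
  have carr: "(a, b, t) \<in> carrier (C_mod p k (e + 1)) \<longleftrightarrow>
      (\<forall>m. a m \<in> carrier (Zloc p)) \<and> b = (\<lambda>m. 0)" for a b t
    by (simp add: C_unfold)
  have cocycle: "C_diff p r k (e + 1) (a, b, t) = \<zero>\<^bsub>C_mod p k (e + 1 + 1)\<^esub> \<longleftrightarrow> t = 0" for a b t
    using p_pos by (simp add: C_unfold)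
  show ?thesis
  proof (rule cohomology_isomorphicI[OF Z.module_axioms])
    show "?g \<in> mod_hom (Zloc p) (C_mod p k (e + 1)) ?Z"
      using Z.smult_l_distr[OF _ _ one] Z.smult_assoc1[OF _ _ one] Z.smult_closed[OF _ one]
      by (auto simp: mod_hom_def C_unfold)
  next
    fix z assume z: "z \<in> carrier ?Z"
    have "of_int z \<odot>\<^bsub>?Z\<^esub> 1 = z"
      using Zmod_smult_one_eq_iff[OF p _ z, of "of_int z"] zero_in_p_multiples[OF p] p by simp
    then show "\<exists>x\<in>carrier (C_mod p k (e + 1)).
        C_diff p r k (e + 1) x = \<zero>\<^bsub>C_mod p k (e + 1 + 1)\<^esub> \<and> ?g x = z"
      using p by (intro bexI[of _ "(\<lambda>m. of_int z, \<lambda>m. 0, 0)"]) (simp_all add: carr cocycle[simplified])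
  next
    fix x assume x: "x \<in> carrier (C_mod p k (e + 1))"
      "C_diff p r k (e + 1) x = \<zero>\<^bsub>C_mod p k (e + 1 + 1)\<^esub>"
    obtain a b t where abt: "x = (a, b, t)"
      by (cases x)
    have a: "\<And>m. a m \<in> carrier (Zloc p)" and x_eq: "x = (a, \<lambda>m. 0, 0)"
      using x unfolding abt carr cocycle by simp_all
    have "?g x = \<zero>\<^bsub>?Z\<^esub> \<longleftrightarrow> a 0 \<in> p_multiples p n"
      using Zmod_smult_one_eq_iff[OF p a Z.zero_closed] by (simp add: zero x_eq)
    then show "?g x = \<zero>\<^bsub>?Z\<^esub> \<longleftrightarrow> x \<in> C_diff p r k (e + 1 - 1) ` carrier (C_mod p k (e + 1 - 1))"
      using coboundary_e_plus_1_iff[OF a] by (simp add: x_eq)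
  qed
qed

end

theorem theorem11:
  fixes p :: nat and r k :: int
  assumes "prime p" and "odd p" and "k \<noteq> 0"
    and "generate (units_of (residue_ring (int p ^ 2))) {r mod int p ^ 2}
           = carrier (units_of (residue_ring (int p ^ 2)))"
  shows "module_isomorphic (Zloc p)
           (cohomology (C_mod p k) (C_diff p r k) ((2 * int p - 2) * k + 1))
           (Zmod_module p (multiplicity (int p) k + 1))
       \<and> is_zero_module (cohomology (C_mod p k) (C_diff p r k) ((2 * int p - 2) * k - 1))
       \<and> is_zero_module (cohomology (C_mod p k) (C_diff p r k) ((2 * int p - 2) * k))
       \<and> is_zero_module (cohomology (C_mod p k) (C_diff p r k) ((2 * int p - 2) * k + 2))"
proof -
  \<comment> \<open>A generator is in particular a unit modulo \<open>p\<^sup>2\<close>.\<close>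
  have r: "coprime r (int p)"
    using assms(1,4) by (rule coprime_generator)
  show ?thesis
    using cohomology_e_plus_1_isomorphic[OF assms(1) r refl refl] cohomology_e_minus_1_zero[OF assms(1) r refl refl]
      cohomology_e_zero[OF assms(1) r refl refl] cohomology_e_plus_2_zero[OF assms(1) r refl refl] by blast
qed

end
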